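(* Let $f\colon X\to X$ be a first-time sensitive homeomorphism of a compact connected metric space $(X,d)$ satisfying (P1) and (P2), and let $\varepsilon$, $(r_k)_k$, $(m_\gamma)_{\gamma\in(0,\varepsilon]}$ and $\mathcal F^u$ be as fixed in the context. If $C\in\mathcal F^u$, then $\lim_{n\to\infty}\operatorname{diam}(f^{-n}(C))=0$.
   Context: $B(x,r)$ denotes the open ball. (P1): there exists $r>0$ such that $B(x,r')$ is connected for every $r'\in(0,r)$ and every $x\in X$. (P2): the map $(x,s)\mapsto\overline{B(x,s)}$ is continuous in the Hausdorff topology. A map $f$ is sensitive with sensitivity constant $\varepsilon>0$ if for every $x\in X$ and $\delta>0$ there exist $y\in X$ with $d(x,y)<\delta$ and $n\in\mathbb N$ with $d(f^n(x),f^n(y))>\varepsilon$. Any smaller positive number is then also a sensitivity constant. The first increasing time $n_1(x,r,\gamma)$, for a sensitivity constant $\gamma$, is the first iterate $n\ge0$ with $\operatorname{diam}f^n(B(x,r))>\gamma$. A sensitive homeomorphism $f$ with sensitivity constant $\varepsilon$ is first-time sensitive if there is a sequence of functions $r_k\colon X\to(0,\infty)$, $k\in\mathbb N=\{1,2,\dots\}$, with $r_1$ constant and $(r_k(x))_k$ decreasing monotonically to $0$ for each $x$, such that for each $\gamma\in(0,\varepsilon]$ there is $m_\gamma>0$ satisfying (F1) $|n_1(x,r_{k+1}(x),\gamma)-n_1(x,r_k(x),\gamma)|\leq m_\gamma$ and (F2) $|n_1(x,r_k(x),\gamma)-n_1(x,r_k(x),\varepsilon)|\leq m_\gamma$ for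 every $x\in X$ and every $k$ with $r_k(x)\leq\gamma$. Fixed data: $f$ is first-time sensitive with a sensitivity constant $c$; $r\in(0,c)$ is such that all balls of radius less than $r$ are connected, and $\varepsilon\in(0,r)$ is fixed (first-time sensitivity then also holds with $\varepsilon$ in place of $c$). Functions $(r_k)_k$ and positive integers $m_\gamma$, $\gamma\in(0,\varepsilon]$, as in the definition of first-time sensitivity for $\varepsilon$ are fixed. For $\gamma\in(0,\varepsilon]$, $\mathcal F^u_\gamma$ is the set of all Hausdorff limits $C=\lim_{k\to\infty}f^{n_k}\big(\overline{B(f^{-n_k}(x),r_{n_k})}\big)$, where $x\in X$, $n_k\to\infty$ are positive integers, $r_{n_k}\to0$ are radii of the form $r_{n_k}=r_{j_k}(f^{-n_k}(x))$ with $j_k\in\mathbb N$, and $n_1(f^{-n_k}(x),r_{n_k},\gamma)\in(n_k,n_k+m_\gamma]$ for every $k$. Set $\mathcal F^u=\bigcup_{\gamma\in(0,\varepsilon]}\mathcal F^u_\gamma$. *)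

theory Defs
  imports "HOL-Analysis.Analysis"
begin

text \<open>
  The space \<open>X\<close> is the universe of a type of class \<^class>\<open>metric_space\<close>; closed balls of the
  mathematical text are closures of open balls, which may differ from \<^const>\<open>cball\<close>.
\<close>

text \<open>Meaningful for nonempty bounded sets only; it is a metric on the nonempty compact ones.\<close>

definition hausdist :: "'a::metric_space set \<Rightarrow> 'a set \<Rightarrow> real" where
  "hausdist A B = max (SUP a\<in>A. infdist a B) (SUP b\<in>B. infdist b A)"

definition hausdorff_limit :: "(nat \<Rightarrow> 'a::metric_space set) \<Rightarrow> 'a set \<Rightarrow> bool" where
  "hausdorff_limit A C \<longleftrightarrow>
     C \<noteq> {} \<and> compact C \<and> ((\<lambda>k. hausdist (A k) C) \<longlonglongrightarrow> 0)"

definition hausdorff_continuous_on ::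
    "'b::topological_space set \<Rightarrow> ('b \<Rightarrow> 'a::metric_space set) \<Rightarrow> bool" where
  "hausdorff_continuous_on S F \<longleftrightarrow>
     (\<forall>p\<in>S. ((\<lambda>q. hausdist (F q) (F p)) \<longlongrightarrow> 0) (at p within S))"

definition balls_connected_below :: "'a::metric_space itself \<Rightarrow> real \<Rightarrow> bool" where
  "balls_connected_below _ r \<longleftrightarrow> (\<forall>r'\<in>{0<..<r}. \<forall>x::'a. connected (ball x r'))"

definition P1 :: "'a::metric_space itself \<Rightarrow> bool" where
  "P1 T \<longleftrightarrow> (\<exists>r>0. balls_connected_below T r)"

text \<open>Radii are positive: \<open>closure (ball x 0)\<close> is empty, hence not a point of the hyperspace.\<close>

definition P2 :: "'a::metric_space itself \<Rightarrow> bool" where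
  "P2 _ \<longleftrightarrow>
     hausdorff_continuous_on (UNIV \<times> {0<..}) (\<lambda>(x::'a, s::real). closure (ball x s))"

definition sensitive :: "('a::metric_space \<Rightarrow> 'a) \<Rightarrow> real \<Rightarrow> bool" where
  "sensitive f \<epsilon> \<longleftrightarrow>
     \<epsilon> > 0 \<and>
     (\<forall>x. \<forall>\<delta>>0. \<exists>y. \<exists>n\<ge>1. dist x y < \<delta> \<and> dist ((f ^^ n) x) ((f ^^ n) y) > \<epsilon>)"

text \<open>The set of such \<open>n\<close> is nonempty if \<open>r > 0\<close> and \<open>\<gamma>\<close> is a sensitivity constant (on a bounded space).\<close>

definition first_incr_time ::
    "('a::metric_space \<Rightarrow> 'a) \<Rightarrow> 'a \<Rightarrow> real \<Rightarrow> real \<Rightarrow> nat" where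
  "first_incr_time f x r \<gamma> = (LEAST n. diameter ((f ^^ n) ` ball x r) > \<gamma>)"

text \<open>Sequences of radius functions are indexed from 1; the value at index 0 is irrelevant.\<close>

definition radius_sequence :: "(nat \<Rightarrow> 'a \<Rightarrow> real) \<Rightarrow> bool" where
  "radius_sequence rs \<longleftrightarrow>
     (\<forall>k\<ge>1. \<forall>x. rs k x > 0) \<and>
     (\<exists>\<rho>. \<forall>x. rs 1 x = \<rho>) \<and>
     (\<forall>x. \<forall>k\<ge>1. rs (Suc k) x \<le> rs k x) \<and>
     (\<forall>x. (\<lambda>k. rs k x) \<longlonglongrightarrow> 0)"

definition F1 ::
    "('a::metric_space \<Rightarrow> 'a) \<Rightarrow> (nat \<Rightarrow> 'a \<Rightarrow> real) \<Rightarrow> real \<Rightarrow> real \<Rightarrow> bool" where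
  "F1 f rs \<gamma> m \<longleftrightarrow>
     (\<forall>x. \<forall>k\<ge>1. rs k x \<le> \<gamma> \<longrightarrow>
        \<bar>real (first_incr_time f x (rs (Suc k) x) \<gamma>)
          - real (first_incr_time f x (rs k x) \<gamma>)\<bar> \<le> m)"

definition F2 ::
    "('a::metric_space \<Rightarrow> 'a) \<Rightarrow> real \<Rightarrow> (nat \<Rightarrow> 'a \<Rightarrow> real) \<Rightarrow> real \<Rightarrow> real \<Rightarrow> bool" where
  "F2 f \<epsilon> rs \<gamma> m \<longleftrightarrow>
     (\<forall>x. \<forall>k\<ge>1. rs k x \<le> \<gamma> \<longrightarrow>
        \<bar>real (first_incr_time f x (rs k x) \<gamma>)
          - real (first_incr_time f x (rs k x) \<epsilon>)\<bar> \<le> m)"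

definition first_time_sensitive :: "('a::metric_space \<Rightarrow> 'a) \<Rightarrow> real \<Rightarrow> bool" where
  "first_time_sensitive f \<epsilon> \<longleftrightarrow>
     homeomorphism UNIV UNIV f (inv f) \<and> sensitive f \<epsilon> \<and>
     (\<exists>rs. radius_sequence rs \<and>
        (\<forall>\<gamma>\<in>{0<..\<epsilon>}. \<exists>m>0. F1 f rs \<gamma> m \<and> F2 f \<epsilon> rs \<gamma> m))"

definition Fu_at ::
    "('a::metric_space \<Rightarrow> 'a) \<Rightarrow> (nat \<Rightarrow> 'a \<Rightarrow> real) \<Rightarrow> (real \<Rightarrow> nat) \<Rightarrow> real \<Rightarrow> 'a set set" where
  "Fu_at f rs m \<gamma> =
     {C. \<exists>(x::'a) (n::nat \<Rightarrow> nat) (j::nat \<Rightarrow> nat) (y::nat \<Rightarrow> 'a) (\<rho>::nat \<Rightarrow> real).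
        (\<forall>k. n k \<ge> 1 \<and> j k \<ge> 1 \<and>
             y k = (inv f ^^ n k) x \<and> \<rho> k = rs (j k) (y k) \<and>
             first_incr_time f (y k) (\<rho> k) \<gamma> \<in> {n k <.. n k + m \<gamma>}) \<and>
        filterlim n at_top sequentially \<and>
        \<rho> \<longlonglongrightarrow> 0 \<and>
        hausdorff_limit (\<lambda>k. (f ^^ n k) ` closure (ball (y k) (\<rho> k))) C}"

definition Fu ::
    "('a::metric_space \<Rightarrow> 'a) \<Rightarrow> real \<Rightarrow> (nat \<Rightarrow> 'a \<Rightarrow> real) \<Rightarrow> (real \<Rightarrow> nat) \<Rightarrow> 'a set set" where
  "Fu f \<epsilon> rs m = (\<Union>\<gamma>\<in>{0<..\<epsilon>}. Fu_at f rs m \<gamma>)"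

end

theory Submission
  imports Defs
begin

text \<open>
  Let \<open>A k = (f ^^ n k) ` closure (ball (y k) (\<rho> k))\<close> be the sets converging to \<open>C\<close>, where \<open>\<rho> k\<close>
  tends to \<open>0\<close> and the ball around \<open>y k\<close> exceeds diameter \<open>\<gamma>\<close> only after time \<open>n k\<close>.  Fix a threshold
  \<open>\<eta>\<close> with \<open>0 < \<eta> \<le> \<epsilon>\<close>.  F2, used once for \<open>\<gamma>\<close> and once for \<open>\<eta>\<close>, compares both first increasing
  times with the one for \<open>\<epsilon>\<close>, so for small balls they differ by at most \<open>m \<gamma> + m \<eta>\<close>
  (\<open>first_incr_time_le_add\<close>).  Hence, for large \<open>k\<close>, the ball around \<open>y k\<close> cannot exceed diameter
  \<open>\<eta>\<close> up to time \<open>n k - (m \<gamma> + m \<eta>)\<close>.  If \<open>p \<ge> m \<gamma> + m \<eta>\<close>, then, again for large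
  \<open>k\<close>, pulling \<open>A k\<close> back by \<open>p\<close> steps gives the image of the closed ball at the time \<open>n k - p\<close>,
  which therefore has diameter at most \<open>\<eta>\<close>.

  The condition on \<open>p\<close> does not involve \<open>k\<close>, so for each fixed \<open>p\<close> the estimate survives the limit in
  \<open>k\<close> and bounds the diameter of the \<open>p\<close>-th preimage of \<open>C\<close>
  (\<open>diameter_image_hausdorff_limit_le\<close>).  Since \<open>\<eta>\<close> is arbitrary, these diameters tend to \<open>0\<close>.
\<close>

lemma infdist_le_hausdist:
  fixes A B :: "'a::metric_space set"
  assumes "bounded B" and "A \<noteq> {}" and "b \<in> B"
  shows "infdist b A \<le> hausdist A B"
proof -
  obtain a where a: "a \<in> A" using \<open>A \<noteq> {}\<close> by blast
  obtain M where M: "\<And>x. x \<in> B \<Longrightarrow> dist a x \<le> M"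
    using \<open>bounded B\<close> bounded_any_center[of B a] by blast
  have "bdd_above ((\<lambda>b. infdist b A) ` B)"
  proof (rule bdd_aboveI2)
    fix x assume "x \<in> B"
    then show "infdist x A \<le> M"
      using infdist_le2[OF a, of x M] M[of x] by (simp add: dist_commute)
  qed
  then have "infdist b A \<le> (SUP b\<in>B. infdist b A)"
    using \<open>b \<in> B\<close> by (rule cSUP_upper2) auto
  then show ?thesis by (simp add: hausdist_def)
qed

lemma hausdorff_limit_approx:
  fixes A :: "nat \<Rightarrow> 'a::metric_space set"
  assumes lim: "hausdorff_limit A C" and ne: "\<And>k. A k \<noteq> {}" and "p \<in> C"
  obtains a where "\<And>k. a k \<in> A k" and "a \<longlonglongrightarrow> p"
proof -
  have "\<exists>q\<in>A k. dist p q < hausdist (A k) C + inverse (real (Suc k))" for k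
  proof -
    have "infdist p (A k) \<le> hausdist (A k) C"
      using lim ne \<open>p \<in> C\<close>
      by (intro infdist_le_hausdist) (auto simp: hausdorff_limit_def compact_imp_bounded)
    then have "(INF q\<in>A k. dist p q) < hausdist (A k) C + inverse (real (Suc k))"
      unfolding infdist_notempty[OF ne] by (rule le_less_trans) simp
    then show ?thesis using cInf_lessD[of "dist p ` A k"] ne by auto
  qed
  then obtain a where a: "\<And>k. a k \<in> A k"
    and d: "\<And>k. dist p (a k) < hausdist (A k) C + inverse (real (Suc k))"
    by metis
  have "(\<lambda>k. hausdist (A k) C + inverse (real (Suc k))) \<longlonglongrightarrow> 0 + 0"
    using lim by (intro tendsto_add LIMSEQ_inverse_real_of_nat) (simp add: hausdorff_limit_def)
  then have "(\<lambda>k. hausdist (A k) C + inverse (real (Suc k))) \<longlonglongrightarrow> 0"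
    by simp
  then have "(\<lambda>k. dist (a k) p) \<longlonglongrightarrow> 0"
  proof (rule tendsto_sandwich[OF _ _ tendsto_const, rotated 2])
    show "\<forall>\<^sub>F k in sequentially. dist (a k) p \<le> hausdist (A k) C + inverse (real (Suc k))"
      unfolding dist_commute[of _ p] by (intro always_eventually allI less_imp_le d)
  qed simp
  then show thesis using a that tendsto_dist_iff by blast
qed

lemma diameter_le_if_dist_le:
  fixes S :: "'a::metric_space set"
  assumes "S \<noteq> {}" and "\<And>x y. x \<in> S \<Longrightarrow> y \<in> S \<Longrightarrow> dist x y \<le> \<eta>"
  shows "diameter S \<le> \<eta>"
  using assms by (auto simp: diameter_def intro!: cSUP_least)

text \<open>
  Any two points of the limit are limits of points of the approximating sets, so the bound passes to
  the images of \<open>C\<close> one pair of points at a time.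
\<close>

lemma diameter_image_hausdorff_limit_le:
  fixes A :: "nat \<Rightarrow> 'a::metric_space set" and g :: "'a \<Rightarrow> 'b::metric_space"
  assumes lim: "hausdorff_limit A C" and ne: "\<And>k. A k \<noteq> {}"
    and g: "continuous_on UNIV g" and bd: "\<And>k. bounded (g ` A k)"
    and le: "\<forall>\<^sub>F k in sequentially. diameter (g ` A k) \<le> \<eta>"
  shows "diameter (g ` C) \<le> \<eta>"
proof (rule diameter_le_if_dist_le)
  show "g ` C \<noteq> {}" using lim by (simp add: hausdorff_limit_def)
next
  fix u v assume "u \<in> g ` C" and "v \<in> g ` C"
  then obtain p q where p: "p \<in> C" "u = g p" and q: "q \<in> C" "v = g q" by blast
  obtain a where a: "\<And>k. a k \<in> A k" "a \<longlonglongrightarrow> p"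
    by (rule hausdorff_limit_approx[OF lim ne p(1)]) blast
  obtain b where b: "\<And>k. b k \<in> A k" "b \<longlonglongrightarrow> q"
    by (rule hausdorff_limit_approx[OF lim ne q(1)]) blast
  have "(\<lambda>k. g (a k)) \<longlonglongrightarrow> g p" "(\<lambda>k. g (b k)) \<longlonglongrightarrow> g q"
    using continuous_on_tendsto_compose[OF g a(2)] continuous_on_tendsto_compose[OF g b(2)]
    by simp_all
  then have "(\<lambda>k. dist (g (a k)) (g (b k))) \<longlonglongrightarrow> dist (g p) (g q)"
    by (rule tendsto_dist)
  moreover have "\<forall>\<^sub>F k in sequentially. dist (g (a k)) (g (b k)) \<le> \<eta>"
    using le
  proof eventually_elim
    case (elim k)
    have "dist (g (a k)) (g (b k)) \<le> diameter (g ` A k)"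
      using a(1) b(1) bd by (intro diameter_bounded_bound) auto
    with elim show ?case by linarith
  qed
  ultimately show "dist u v \<le> \<eta>"
    unfolding p q by (rule tendsto_upperbound) simp
qed

lemma continuous_on_funpow:
  fixes g :: "'a::topological_space \<Rightarrow> 'a"
  assumes "continuous_on UNIV g"
  shows "continuous_on UNIV (g ^^ n)"
  by (induction n)
     (auto intro: continuous_on_compose continuous_on_subset[OF assms] simp del: o_apply)

lemma inv_funpow_funpow:
  assumes "inj f" and "n \<le> N"
  shows "(inv f ^^ n) ((f ^^ N) x) = (f ^^ (N - n)) x"
proof -
  have "(inv f ^^ n) ((f ^^ (n + l)) x) = (f ^^ l) x" for l
    by (induction n) (auto simp: funpow_swap1[of "inv f"] inv_f_f[OF \<open>inj f\<close>])
  from this[of "N - n"] show ?thesis using \<open>n \<le> N\<close> by simp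
qed

lemma diameter_image_closure_le:
  fixes g :: "'a::metric_space \<Rightarrow> 'b::metric_space"
  assumes "continuous_on UNIV g" and "bounded (g ` S)"
  shows "diameter (g ` closure S) \<le> diameter (g ` S)"
proof -
  have "g ` closure S \<subseteq> closure (g ` S)"
    by (rule image_closure_subset[OF continuous_on_subset[OF assms(1)]])
       (auto intro: closure_subset[THEN subsetD])
  then have "diameter (g ` closure S) \<le> diameter (closure (g ` S))"
    using assms(2) by (intro diameter_subset bounded_closure)
  also have "\<dots> = diameter (g ` S)" using assms(2) by (rule diameter_closure)
  finally show ?thesis .
qed

lemma diameter_le_if_before_first_incr_time:
  assumes "n < first_incr_time f x s \<eta>"
  shows "diameter ((f ^^ n) ` ball x s) \<le> \<eta>"
  using not_less_Least[OF assms[unfolded first_incr_time_def]] by simp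

text \<open>
  F2 compares the thresholds \<open>\<gamma>\<close> and \<open>\<eta>\<close> only with \<open>\<epsilon>\<close>; passing through \<open>\<epsilon>\<close> compares them with
  each other, with a gap that depends neither on the point nor on the radius.
\<close>

lemma first_incr_time_le_add:
  assumes "F2 f \<epsilon> rs \<gamma> (real M)" and "F2 f \<epsilon> rs \<eta> (real N)"
    and "j \<ge> 1" and "rs j x \<le> \<gamma>" and "rs j x \<le> \<eta>"
  shows "first_incr_time f x (rs j x) \<gamma> \<le> first_incr_time f x (rs j x) \<eta> + (M + N)"
proof -
  have "\<bar>real (first_incr_time f x (rs j x) \<gamma>) - real (first_incr_time f x (rs j x) \<epsilon>)\<bar> \<le> real M"
    "\<bar>real (first_incr_time f x (rs j x) \<eta>) - real (first_incr_time f x (rs j x) \<epsilon>)\<bar> \<le> real N"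
    using assms unfolding F2_def by blast+
  then show ?thesis by linarith
qed

lemma diameter_inv_image_Fu_at_le:
  fixes f :: "'a::metric_space \<Rightarrow> 'a"
  assumes X: "bounded (UNIV :: 'a set)"
    and f: "homeomorphism UNIV UNIV f (inv f)"
    and rs: "radius_sequence rs"
    and F2: "F2 f \<epsilon> rs \<gamma> (real (m \<gamma>))" "F2 f \<epsilon> rs \<eta> (real N)"
    and pos: "0 < \<gamma>" "0 < \<eta>"
    and C: "C \<in> Fu_at f rs m \<gamma>"
    and n: "m \<gamma> + N \<le> n"
  shows "diameter ((inv f ^^ n) ` C) \<le> \<eta>"
proof -
  obtain t :: "nat \<Rightarrow> nat" and j :: "nat \<Rightarrow> nat" and y :: "nat \<Rightarrow> 'a" and \<rho> :: "nat \<Rightarrow> real"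
    where j: "\<And>k. j k \<ge> 1" and \<rho>: "\<And>k. \<rho> k = rs (j k) (y k)"
      and late: "\<And>k. t k < first_incr_time f (y k) (\<rho> k) \<gamma>"
      and t_lim: "filterlim t at_top sequentially" and \<rho>_lim: "\<rho> \<longlonglongrightarrow> 0"
      and lim: "hausdorff_limit (\<lambda>k. (f ^^ t k) ` closure (ball (y k) (\<rho> k))) C"
    using C unfolding Fu_at_def mem_Collect_eq greaterThanAtMost_iff by blast
  have bdd: "bounded S" for S :: "'a set" using X by (rule bounded_subset) simp
  have cont: "continuous_on UNIV f" "continuous_on UNIV (inv f)"
    using f by (auto simp: homeomorphism_def)
  have "inj f" using f by (intro inj_on_inverseI[where g = "inv f"]) (auto simp: homeomorphism_def)
  have ne: "(f ^^ t k) ` closure (ball (y k) (\<rho> k)) \<noteq> {}" for k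
  proof -
    have "\<rho> k > 0" using rs j[of k] by (simp add: \<rho> radius_sequence_def)
    then show ?thesis by simp
  qed
  have "\<forall>\<^sub>F k in sequentially. n \<le> t k"
    using t_lim by (simp add: filterlim_at_top)
  moreover have "\<forall>\<^sub>F k in sequentially. \<rho> k < min \<gamma> \<eta>"
    using \<rho>_lim pos by (intro order_tendstoD) auto
  ultimately have ev: "\<forall>\<^sub>F k in sequentially.
      diameter ((inv f ^^ n) ` (f ^^ t k) ` closure (ball (y k) (\<rho> k))) \<le> \<eta>"
  proof eventually_elim
    case (elim k)
    have "first_incr_time f (y k) (\<rho> k) \<gamma> \<le> first_incr_time f (y k) (\<rho> k) \<eta> + (m \<gamma> + N)"
      unfolding \<rho> using F2 j elim(2) by (intro first_incr_time_le_add) (auto simp: \<rho>)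
    with late[of k] n elim(1) have "t k - n < first_incr_time f (y k) (\<rho> k) \<eta>"
      by linarith
    then have "diameter ((f ^^ (t k - n)) ` ball (y k) (\<rho> k)) \<le> \<eta>"
      by (rule diameter_le_if_before_first_incr_time)
    moreover have "(inv f ^^ n) ` (f ^^ t k) ` S = (f ^^ (t k - n)) ` S" for S
      using inv_funpow_funpow[OF \<open>inj f\<close> elim(1)] by (simp add: image_image)
    ultimately show ?case
      using diameter_image_closure_le[OF continuous_on_funpow[OF cont(1)] bdd]
      by (metis order_trans)
  qed
  show ?thesis
    by (rule diameter_image_hausdorff_limit_le[OF lim ne continuous_on_funpow[OF cont(2)] bdd ev])
qed

theorem proposition2p11:
  fixes f :: "'a::metric_space \<Rightarrow> 'a"
    and c r \<epsilon> :: real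
    and rs :: "nat \<Rightarrow> 'a \<Rightarrow> real"
    and m :: "real \<Rightarrow> nat"
    and C :: "'a set"
  assumes "compact (UNIV :: 'a set)" and "connected (UNIV :: 'a set)"
    and "P1 TYPE('a)" and "P2 TYPE('a)"
    and "first_time_sensitive f c"
    and "0 < r" and "r < c" and "balls_connected_below TYPE('a) r"
    and "0 < \<epsilon>" and "\<epsilon> < r"
    and "radius_sequence rs"
    and "\<And>\<gamma>. \<gamma> \<in> {0<..\<epsilon>} \<Longrightarrow> m \<gamma> > 0 \<and> F1 f rs \<gamma> (real (m \<gamma>)) \<and> F2 f \<epsilon> rs \<gamma> (real (m \<gamma>))"
    and "C \<in> Fu f \<epsilon> rs m"
  shows "(\<lambda>n. diameter ((inv f ^^ n) ` C)) \<longlonglongrightarrow> 0"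
proof -
  obtain \<gamma> where \<gamma>: "\<gamma> \<in> {0<..\<epsilon>}" and C: "C \<in> Fu_at f rs m \<gamma>"
    using \<open>C \<in> Fu f \<epsilon> rs m\<close> unfolding Fu_def by blast
  have X: "bounded (UNIV :: 'a set)" using assms(1) by (rule compact_imp_bounded)
  have f: "homeomorphism UNIV UNIV f (inv f)"
    using assms(5) by (simp add: first_time_sensitive_def)
  show ?thesis
  proof (rule LIMSEQ_I)
    fix e :: real assume "0 < e"
    \<comment> \<open>F2 holds for thresholds up to \<open>\<epsilon>\<close>, hence the minimum; halving makes the bound strict.\<close>
    define \<eta> where "\<eta> = min \<epsilon> (e / 2)"
    have \<eta>: "\<eta> \<in> {0<..\<epsilon>}" "\<eta> < e"
      using \<open>0 < e\<close> \<open>0 < \<epsilon>\<close> by (auto simp: \<eta>_def)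
    have "norm (diameter ((inv f ^^ n) ` C) - 0) < e" if "m \<gamma> + m \<eta> \<le> n" for n
    proof -
      have "diameter ((inv f ^^ n) ` C) \<le> \<eta>"
        using diameter_inv_image_Fu_at_le[OF X f assms(11) _ _ _ _ C that, of \<epsilon> \<eta>]
          assms(12)[OF \<gamma>] assms(12)[OF \<eta>(1)] \<gamma> \<eta>(1) by simp
      moreover have "0 \<le> diameter ((inv f ^^ n) ` C)"
        by (rule diameter_ge_0[OF bounded_subset[OF X subset_UNIV]])
      ultimately show ?thesis using \<eta>(2) by simp
    qed
    then show "\<exists>n0. \<forall>n\<ge>n0. norm (diameter ((inv f ^^ n) ` C) - 0) < e" by blast
  qed
qed

end
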